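(* Let $r\ge 2$ be an integer and let $F$ be a graph such that (i) $\mathrm{ex}(n,K_3,F)=o(n^2)$, and (ii) there is a constant $c<1/r$ such that for all sufficiently large $n$, every $n$-vertex $F$-free graph that contains a triangle has a vertex of degree less than $cn$. Then $\mathrm{ex}_r(n,\mathcal{S}^rF)\le \frac{n}{r^2}\binom{n}{r-1}$ for all sufficiently large $n$.
   Context: $\mathrm{ex}(n,K_3,F)$ denotes the maximum number of triangles in an $n$-vertex graph containing no copy of $F$. For a graph $F$ and integer $r\ge 2$, the $r$-uniform suspension $\mathcal{S}^rF$ is the $r$-uniform hypergraph obtained from $F$ by adding $r-2$ new vertices and adding all of them to every edge of $F$. $\mathrm{ex}_r(n,\mathcal{F})$ denotes the maximum number of hyperedges in an $n$-vertex $r$-uniform hypergraph not containing $\mathcal{F}$ as a subhypergraph. *)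

theory Defs
  imports Complex_Main "HOL-Library.Landau_Symbols"
begin

text \<open>
  A hypergraph is a pair of a vertex set and an edge set. A (finite simple) graph is a
  \<open>2\<close>-uniform hypergraph, so that containment and the suspension are shared by graphs and
  hypergraphs.
\<close>

type_synonym 'a hypergraph = "'a set \<times> 'a set set"

abbreviation verts :: "'a hypergraph \<Rightarrow> 'a set" where
  "verts H \<equiv> fst H"

abbreviation edges :: "'a hypergraph \<Rightarrow> 'a set set" where
  "edges H \<equiv> snd H"

definition uniform :: "nat \<Rightarrow> 'a hypergraph \<Rightarrow> bool" where
  "uniform r H \<longleftrightarrow> finite (verts H) \<and> (\<forall>e\<in>edges H. e \<subseteq> verts H \<and> card e = r)"

abbreviation simple_graph :: "'a hypergraph \<Rightarrow> bool" where
  "simple_graph G \<equiv> uniform 2 G"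

text \<open>Containment is not necessarily induced; isolated vertices of \<open>F\<close> are embedded as well.\<close>

definition contains_copy :: "'a hypergraph \<Rightarrow> 'b hypergraph \<Rightarrow> bool" where
  "contains_copy H F \<longleftrightarrow>
     (\<exists>f. inj_on f (verts F) \<and> f ` verts F \<subseteq> verts H \<and> (\<forall>e\<in>edges F. f ` e \<in> edges H))"

definition degree :: "'a hypergraph \<Rightarrow> 'a \<Rightarrow> nat" where
  "degree G v = card {e \<in> edges G. v \<in> e}"

definition triangles :: "'a hypergraph \<Rightarrow> 'a set set" where
  "triangles G = {T. T \<subseteq> verts G \<and> card T = 3 \<and> (\<forall>x\<in>T. \<forall>y\<in>T. x \<noteq> y \<longrightarrow> {x, y} \<in> edges G)}"

text \<open>The \<open>r - 2\<close> new vertices are \<open>Inr 0, \<dots>, Inr (r - 3)\<close>; intended for \<open>r \<ge> 2\<close>.\<close>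

definition suspension :: "nat \<Rightarrow> 'a hypergraph \<Rightarrow> ('a + nat) hypergraph" where
  "suspension r F =
     (Inl ` verts F \<union> Inr ` {..<r - 2}, (\<lambda>e. Inl ` e \<union> Inr ` {..<r - 2}) ` edges F)"

text \<open>
  Vertices of host (hyper)graphs are natural numbers, which covers every finite (hyper)graph up
  to isomorphism. The suprema below are over finite sets of naturals and hence maxima, except
  that they are \<open>0\<close> if there is no \<open>F\<close>-free host on \<open>n\<close> vertices (which, for large \<open>n\<close>, happens
  only for edgeless \<open>F\<close>).
\<close>

definition turan_number :: "nat \<Rightarrow> nat \<Rightarrow> 'a hypergraph \<Rightarrow> nat" where
  "turan_number r n F =
     Sup {card (edges H) | H :: nat hypergraph.
            uniform r H \<and> card (verts H) = n \<and> \<not> contains_copy H F}"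

definition turan_triangles :: "nat \<Rightarrow> 'a hypergraph \<Rightarrow> nat" where
  "turan_triangles n F =
     Sup {card (triangles G) | G :: nat hypergraph.
            simple_graph G \<and> card (verts G) = n \<and> \<not> contains_copy G F}"

end

theory Submission
  imports Defs
begin

text \<open>
  Let \<open>H\<close> be free of the suspension, write \<open>d(S)\<close> for the codegree of an \<open>(r - 1)\<close>-set \<open>S\<close>, and
  let \<open>t\<close> be the total number of triangles in the links of \<open>(r - 2)\<close>-sets, all of which are
  \<open>F\<close>-free. Given an edge \<open>e\<close> and a vertex \<open>v\<close> outside it, two different edges of the form
  \<open>e - x + v\<close> yield a triangle in the link of an \<open>(r - 2)\<close>-subset of \<open>e\<close>; hence
  \<open>\<Sum> d(S)\<^sup>2 \<le> n |H| + O(t)\<close>. If the average codegree \<open>D\<close> exceeded \<open>n / r\<close>, this would give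
  \<open>\<Sum> (d(S) - D)\<^sup>2 < O(t)\<close>, so that the number \<open>b\<close> of sets with \<open>d(S) < c n\<close> would be
  \<open>O(t / n\<^sup>2)\<close>. By (ii) a link that contains a triangle contributes a set with \<open>d(S) < c n\<close>, and
  by (i) it has only \<open>o(n\<^sup>2)\<close> triangles, so \<open>t = o(n\<^sup>2) b\<close>. Therefore \<open>b = t = 0\<close>, and the
  strict inequality above becomes absurd.
\<close>

section \<open>Links, codegrees and copies of the suspension\<close>

definition link :: "'a hypergraph \<Rightarrow> 'a set \<Rightarrow> 'a hypergraph" where
  "link H A = (verts H - A, {p. p \<inter> A = {} \<and> p \<union> A \<in> edges H})"

definition codegree :: "'a hypergraph \<Rightarrow> 'a set \<Rightarrow> nat" where
  "codegree H S = card {e \<in> edges H. S \<subseteq> e}"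

lemma uniform_finite_edges: "uniform r H \<Longrightarrow> finite (edges H)"
  unfolding uniform_def by (meson Pow_iff finite_Pow_iff finite_subset subsetI)

lemma uniform_edgeD:
  assumes "uniform r H" "e \<in> edges H"
  shows "e \<subseteq> verts H" "card e = r" "finite e"
  using assms unfolding uniform_def by (auto intro: finite_subset)

lemma finite_triangles: "finite (verts G) \<Longrightarrow> finite (triangles G)"
  by (rule finite_subset[of _ "Pow (verts G)"]) (auto simp: triangles_def)

text \<open>On naturals \<open>Sup\<close> bounds the members of a set only when the set is bounded
  above. Triangles are vertex subsets, so a power of 2 serves as the bound.\<close>

lemma card_triangles_le_turan_triangles:
  fixes G :: "nat hypergraph"
  assumes "simple_graph G" "\<not> contains_copy G F"
  shows "card (triangles G) \<le> turan_triangles (card (verts G)) F"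
  unfolding turan_triangles_def
proof (rule cSup_upper)
  show "bdd_above {card (triangles G') | G' :: nat hypergraph. simple_graph G' \<and>
      card (verts G') = card (verts G) \<and> \<not> contains_copy G' F}"
  proof (rule bdd_aboveI[where M = "2 ^ card (verts G)"])
    fix k assume "k \<in> {card (triangles G') | G' :: nat hypergraph. simple_graph G' \<and>
      card (verts G') = card (verts G) \<and> \<not> contains_copy G' F}"
    then obtain G' :: "nat hypergraph" where G': "k = card (triangles G')" "simple_graph G'"
      "card (verts G') = card (verts G)" by blast
    have "finite (verts G')" using G' by (simp add: uniform_def)
    then have "card (triangles G') \<le> card (Pow (verts G'))"
      by (intro card_mono) (auto simp: triangles_def)
    then show "k \<le> 2 ^ card (verts G)"
      using G' \<open>finite (verts G')\<close> by (simp add: card_Pow)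
  qed
qed (use assms in blast)

lemma simple_graph_link:
  assumes H: "uniform r H" and A: "card A = r - 2" and r: "r \<ge> 2"
    and AV: "A \<subseteq> verts H"
  shows "simple_graph (link H A)"
  unfolding uniform_def
proof (intro conjI ballI)
  show "finite (verts (link H A))" using H by (simp add: link_def uniform_def)
  fix p assume "p \<in> edges (link H A)"
  then have p: "p \<inter> A = {}" "p \<union> A \<in> edges H" by (auto simp: link_def)
  note pA = uniform_edgeD[OF H p(2)]
  show "p \<subseteq> verts (link H A)" using p pA by (auto simp: link_def)
  have "card (p \<union> A) = card p + card A" using pA p by (intro card_Un_disjoint) auto
  then show "card p = 2" using pA A r by simp
qed

text \<open>An embedding of \<open>F\<close> into the link extends by any bijection from the
  \<open>r - 2\<close> new vertices to \<open>A\<close>. By contraposition, all links of a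
  suspension-free \<open>H\<close> are \<open>F\<close>-free.\<close>

lemma contains_copy_suspension:
  assumes A: "card A = r - 2" "finite A" and AV: "A \<subseteq> verts H"
    and c: "contains_copy (link H A) F"
  shows "contains_copy H (suspension r F)"
proof -
  from c obtain f where f: "inj_on f (verts F)" "f ` verts F \<subseteq> verts H - A"
    "\<And>e. e \<in> edges F \<Longrightarrow> f ` e \<union> A \<in> edges H"
    by (auto simp: contains_copy_def link_def)
  obtain g where g: "bij_betw g {..<r - 2} A"
    using ex_bij_betw_nat_finite[OF A(2)] A(1) by (auto simp: atLeast0LessThan)
  have gi: "inj_on g {..<r - 2}" and ga: "g ` {..<r - 2} = A"
    using g by (auto simp: bij_betw_def)
  let ?h = "case_sum f g"
  have im: "?h ` (Inl ` e \<union> Inr ` {..<r - 2}) = f ` e \<union> A" for e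
    using ga by (simp add: image_Un image_image)
  show ?thesis unfolding contains_copy_def
  proof (intro exI conjI)
    show "inj_on ?h (verts (suspension r F))"
    proof -
      have "inj_on ?h (Inl ` verts F)" "inj_on ?h (Inr ` {..<r - 2})"
        using f(1) gi by (auto simp: inj_on_def)
      moreover have "?h ` Inl ` verts F \<inter> ?h ` Inr ` {..<r - 2} = {}"
        using f(2) ga by (auto simp: image_image)
      ultimately show ?thesis by (simp add: suspension_def inj_on_Un) blast
    qed
    show "?h ` verts (suspension r F) \<subseteq> verts H"
      using im[of "verts F"] f(2) AV by (auto simp: suspension_def)
    show "\<forall>e\<in>edges (suspension r F). ?h ` e \<in> edges H"
      using im f(3) by (auto simp: suspension_def simp del: image_Un)
  qed
qed

text \<open>Removing \<open>A\<close> maps edges through \<open>insert v A\<close> injectively to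
  link edges at \<open>v\<close>. A vertex of small degree in a link thus produces an
  \<open>(r - 1)\<close>-set of small codegree.\<close>

lemma codegree_insert_le_degree_link:
  assumes "uniform r H" "v \<notin> A"
  shows "codegree H (insert v A) \<le> degree (link H A) v"
  unfolding codegree_def degree_def
proof (rule card_inj_on_le)
  show "inj_on (\<lambda>e. e - A) {e \<in> edges H. insert v A \<subseteq> e}" by (auto simp: inj_on_def)
  show "(\<lambda>e. e - A) ` {e \<in> edges H. insert v A \<subseteq> e} \<subseteq> {e \<in> edges (link H A). v \<in> e}"
    using assms(2) by (auto simp: link_def Un_absorb2 subset_insertI)
  have "{e \<in> edges (link H A). v \<in> e} \<subseteq> (\<lambda>e. e - A) ` edges H"
  proof
    fix p assume "p \<in> {e \<in> edges (link H A). v \<in> e}"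
    then have "p = (p \<union> A) - A" "p \<union> A \<in> edges H" by (auto simp: link_def)
    then show "p \<in> (\<lambda>e. e - A) ` edges H" by blast
  qed
  then show "finite {e \<in> edges (link H A). v \<in> e}"
    using uniform_finite_edges[OF assms(1)] finite_surj by blast
qed

section \<open>Double counting of codegrees\<close>

text \<open>Both sides count pairs of a \<open>k\<close>-set inside an edge, weighted by
  \<open>w\<close>. Weight 1 gives the first moment of the codegree, weight
  \<open>codegree H\<close> the second.\<close>

lemma sum_codegree_mult:
  fixes w :: "'a set \<Rightarrow> nat"
  assumes H: "uniform r H"
  shows "(\<Sum>S | S \<subseteq> verts H \<and> card S = k. codegree H S * w S) =
         (\<Sum>e\<in>edges H. \<Sum>S | S \<subseteq> e \<and> card S = k. w S)"
proof -
  let ?P = "{S. S \<subseteq> verts H \<and> card S = k}"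
  have fP: "finite ?P" using H by (simp add: uniform_def)
  have "(\<Sum>S\<in>?P. codegree H S * w S) = (\<Sum>S\<in>?P. \<Sum>e | e \<in> edges H \<and> S \<subseteq> e. w S)"
    by (simp add: codegree_def)
  also have "\<dots> = (\<Sum>e\<in>edges H. \<Sum>S | S \<in> ?P \<and> S \<subseteq> e. w S)"
    by (rule sum.swap_restrict[OF fP uniform_finite_edges[OF H]])
  also have "\<dots> = (\<Sum>e\<in>edges H. \<Sum>S | S \<subseteq> e \<and> card S = k. w S)"
    by (intro sum.cong) (use uniform_edgeD(1)[OF H] in blast)+
  finally show ?thesis .
qed

lemma sum_codegree:
  assumes H: "uniform r H"
  shows "(\<Sum>S | S \<subseteq> verts H \<and> card S = k. codegree H S) = (r choose k) * card (edges H)"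
  using sum_codegree_mult[OF H, where k = k and w = "\<lambda>_. 1"] uniform_edgeD[OF H] by (simp add: n_subsets)

section \<open>Vertex exchanges and the second moment of the codegree\<close>

text \<open>Used for \<open>v\<close> outside \<open>e\<close>. Two distinct members
  \<open>x\<close>, \<open>y\<close> then give three edges \<open>e\<close>,
  \<open>e - x + v\<close>, \<open>e - y + v\<close> that share the \<open>(r - 2)\<close>-set
  \<open>e - {x, y}\<close>.\<close>

definition swaps :: "'a hypergraph \<Rightarrow> 'a set \<Rightarrow> 'a \<Rightarrow> 'a set" where
  "swaps H e v = {x \<in> e. insert v (e - {x}) \<in> edges H}"

text \<open>Fixing one \<open>x\<close> in \<open>K\<close>, the pairs \<open>(x, y)\<close> with
  \<open>y\<close> different from \<open>x\<close> already number \<open>card K - 1\<close>. The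
  summand 1 becomes the main term of the second moment, the pairs become triangles.\<close>

lemma card_le_Suc_card_off_diagonal:
  assumes "finite K"
  shows "card K \<le> 1 + card {(x, y). x \<in> K \<and> y \<in> K \<and> x \<noteq> y}"
proof (cases "K = {}")
  case False
  then obtain x where x: "x \<in> K" by blast
  have "card (K - {x}) \<le> card {(x, y). x \<in> K \<and> y \<in> K \<and> x \<noteq> y}"
  proof (rule card_inj_on_le)
    show "inj_on (Pair x) (K - {x})" by (auto simp: inj_on_def)
    show "finite {(x, y). x \<in> K \<and> y \<in> K \<and> x \<noteq> y}"
      by (rule finite_subset[of _ "K \<times> K"]) (use assms in auto)
  qed (use x in auto)
  then show ?thesis using x assms by simp
qed simp

text \<open>The summand 1 is \<open>e\<close> itself; every other edge containing
  \<open>e - {x}\<close> adds a single vertex outside \<open>e\<close>.\<close>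

lemma codegree_edge_minus:
  assumes H: "uniform r H" and e: "e \<in> edges H" and x: "x \<in> e"
  shows "codegree H (e - {x}) = 1 + card {v \<in> verts H - e. insert v (e - {x}) \<in> edges H}"
proof -
  let ?M = "{v \<in> verts H - e. insert v (e - {x}) \<in> edges H}"
  let ?f = "\<lambda>v. insert v (e - {x})"
  have "{e' \<in> edges H. e - {x} \<subseteq> e'} = insert e (?f ` ?M)"
  proof (intro equalityI subsetI)
    fix e' assume e': "e' \<in> {e' \<in> edges H. e - {x} \<subseteq> e'}"
    note E = uniform_edgeD[OF H e] and E' = uniform_edgeD[OF H, of e']
    have "card (e' - (e - {x})) = card e' - card (e - {x})"
      using e' E by (intro card_Diff_subset) auto
    also have "\<dots> = 1" using e' E E' x
      by (metis (mono_tags, lifting) One_nat_def card_Diff_singleton card_gt_0_iff diff_diff_cancel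
        empty_iff less_eq_Suc_le mem_Collect_eq)
    finally obtain v where "e' - (e - {x}) = {v}" by (auto simp: card_1_singleton_iff)
    then have v: "e' = ?f v" "v \<notin> e - {x}" using e' by auto
    show "e' \<in> insert e (?f ` ?M)"
    proof (cases "v = x")
      case True then show ?thesis using v x by auto
    next
      case False
      then have "v \<in> ?M" using v e' E' by auto
      then show ?thesis using v by blast
    qed
  qed (use e in auto)
  moreover have "e \<notin> ?f ` ?M" by auto
  moreover have "inj_on ?f ?M" by (auto simp: inj_on_def)
  moreover have "finite ?M" using H by (simp add: uniform_def)
  ultimately show ?thesis by (simp add: codegree_def card_image)
qed

text \<open>Each of the \<open>r\<close> subsets \<open>e - {x}\<close> counts \<open>e\<close>
  once; the other incidences are pairs of \<open>v\<close> outside \<open>e\<close> and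
  \<open>x\<close> in \<open>swaps H e v\<close>. Every such \<open>v\<close> contributes at most 1
  plus its ordered pairs, and the \<open>r\<close> and the ones add up to
  \<open>card (verts H)\<close>.\<close>

lemma sum_codegree_subsets_edge_le:
  assumes H: "uniform r H" and r: "r \<ge> 1" and e: "e \<in> edges H"
  shows "(\<Sum>S | S \<subseteq> e \<and> card S = r - 1. codegree H S) \<le> card (verts H) +
    (\<Sum>v\<in>verts H - e. card {(x, y). x \<in> swaps H e v \<and> y \<in> swaps H e v \<and> x \<noteq> y})"
proof -
  note E = uniform_edgeD[OF H e]
  have fV: "finite (verts H)" using H by (simp add: uniform_def)
  have "{S. S \<subseteq> e \<and> card S = r - 1} = (\<lambda>x. e - {x}) ` e"
  proof (intro equalityI subsetI)
    fix S assume S: "S \<in> {S. S \<subseteq> e \<and> card S = r - 1}"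
    then have "finite S" using E finite_subset by blast
    then have "card (e - S) = 1" using S E r by (simp add: card_Diff_subset)
    then obtain x where "e - S = {x}" by (auto simp: card_1_singleton_iff)
    then show "S \<in> (\<lambda>x. e - {x}) ` e" using S by (intro image_eqI[of _ _ x]) auto
  qed (use E in auto)
  moreover have "inj_on (\<lambda>x. e - {x}) e" by (auto simp: inj_on_def)
  ultimately have "(\<Sum>S | S \<subseteq> e \<and> card S = r - 1. codegree H S) = (\<Sum>x\<in>e. codegree H (e - {x}))"
    by (simp add: sum.reindex)
  also have "\<dots> = r + (\<Sum>x\<in>e. \<Sum>v | v \<in> verts H - e \<and> insert v (e - {x}) \<in> edges H. 1)"
    using codegree_edge_minus[OF H e] E by (simp add: sum_Suc)
  also have "(\<Sum>x\<in>e. \<Sum>v | v \<in> verts H - e \<and> insert v (e - {x}) \<in> edges H. 1) =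
      (\<Sum>v\<in>verts H - e. \<Sum>x | x \<in> e \<and> insert v (e - {x}) \<in> edges H. 1::nat)"
    by (rule sum.swap_restrict) (use E fV in auto)
  also have "\<dots> = (\<Sum>v\<in>verts H - e. card (swaps H e v))" by (simp add: swaps_def)
  also have "\<dots> \<le> (\<Sum>v\<in>verts H - e.
      1 + card {(x, y). x \<in> swaps H e v \<and> y \<in> swaps H e v \<and> x \<noteq> y})"
    using E by (intro sum_mono card_le_Suc_card_off_diagonal) (simp add: swaps_def)
  also have "r + \<dots> = card (verts H) +
      (\<Sum>v\<in>verts H - e. card {(x, y). x \<in> swaps H e v \<and> y \<in> swaps H e v \<and> x \<noteq> y})"
    using E fV card_mono[OF fV E(1)] by (simp add: sum_Suc card_Diff_subset)
  finally show ?thesis by simp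
qed

text \<open>The coordinates are distinct automatically, since members of \<open>triangles G\<close>
  have three elements. Ordered triples allow an injection from the quadruples
  \<open>(e, v, x, y)\<close>.\<close>

definition ordered_triangles :: "'a hypergraph \<Rightarrow> ('a \<times> 'a \<times> 'a) set" where
  "ordered_triangles G = {(x, y, z). {x, y, z} \<in> triangles G}"

lemma ordered_triangles_le:
  assumes "finite (verts G)"
  shows "finite (ordered_triangles G)" "card (ordered_triangles G) \<le> 27 * card (triangles G)"
proof -
  have sub: "ordered_triangles G \<subseteq> (\<Union>T\<in>triangles G. T \<times> T \<times> T)"
    by (auto simp: ordered_triangles_def)
  have fin: "finite T" "card T = 3" if "T \<in> triangles G" for T
    using that assms by (auto simp: triangles_def intro: finite_subset)
  have fU: "finite (\<Union>T\<in>triangles G. T \<times> T \<times> T)" using fin finite_triangles[OF assms] by auto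
  show "finite (ordered_triangles G)" using sub fU finite_subset by blast
  have "card (ordered_triangles G) \<le> card (\<Union>T\<in>triangles G. T \<times> T \<times> T)"
    by (rule card_mono[OF fU sub])
  also have "\<dots> \<le> (\<Sum>T\<in>triangles G. card (T \<times> T \<times> T))"
    by (rule card_UN_le[OF finite_triangles[OF assms]])
  \<comment> \<open>The crude factor \<open>27 = 3 ^ 3\<close> stands in for the exact 6; only a
    constant matters.\<close>
  also have "\<dots> = 27 * card (triangles G)" using fin by (simp add: card_cartesian_product)
  finally show "card (ordered_triangles G) \<le> 27 * card (triangles G)" .
qed

text \<open>The side \<open>{x, y}\<close> comes from the edge \<open>e\<close>, the side
  \<open>{x, v}\<close> from \<open>e - y + v\<close>, and \<open>{y, v}\<close> from
  \<open>e - x + v\<close>.\<close>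

lemma swaps_triangle_link:
  assumes H: "uniform r H" and e: "e \<in> edges H" and v: "v \<in> verts H - e"
    and xy: "x \<in> swaps H e v" "y \<in> swaps H e v" "x \<noteq> y"
  shows "{x, y, v} \<in> triangles (link H (e - {x, y}))"
proof -
  have x: "x \<in> e" "insert v (e - {x}) \<in> edges H" and y: "y \<in> e" "insert v (e - {y}) \<in> edges H"
    using xy by (auto simp: swaps_def)
  have "{x, y} \<union> (e - {x, y}) = e" "{x, v} \<union> (e - {x, y}) = insert v (e - {y})"
    "{y, v} \<union> (e - {x, y}) = insert v (e - {x})" using x y xy(3) by auto
  then have "{x, y} \<in> edges (link H (e - {x, y}))" "{x, v} \<in> edges (link H (e - {x, y}))"
    "{y, v} \<in> edges (link H (e - {x, y}))" using e x y v unfolding link_def by auto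
  moreover have "x \<noteq> v" "y \<noteq> v" using x(1) y(1) v by auto
  moreover have "{x, y, v} \<subseteq> verts (link H (e - {x, y}))"
    using uniform_edgeD[OF H e] v x(1) y(1) by (auto simp: link_def)
  ultimately show ?thesis
    using xy(3) by (simp add: triangles_def insert_commute)
qed

text \<open>The bound for a single edge is summed over all edges. The error term counts quadruples
  \<open>(e, v, x, y)\<close>, which inject into pairs of an \<open>(r - 2)\<close>-set and an
  ordered triangle of its link.\<close>

lemma sum_codegree_square_le:
  assumes H: "uniform r H" and r: "r \<ge> 2"
  shows "(\<Sum>S | S \<subseteq> verts H \<and> card S = r - 1. (codegree H S)\<^sup>2) \<le>
    card (verts H) * card (edges H) +
    27 * (\<Sum>A | A \<subseteq> verts H \<and> card A = r - 2. card (triangles (link H A)))"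
proof -
  have fV: "finite (verts H)" using H by (simp add: uniform_def)
  note fE = uniform_finite_edges[OF H]
  let ?off = "\<lambda>e v. {(x, y). x \<in> swaps H e v \<and> y \<in> swaps H e v \<and> x \<noteq> y}"
  let ?AA = "{A. A \<subseteq> verts H \<and> card A = r - 2}"
  let ?X = "SIGMA e:edges H. SIGMA v:verts H - e. ?off e v"
  let ?Y = "SIGMA A:?AA. ordered_triangles (link H A)"
  let ?f = "\<lambda>(e, v, x, y). (e - {x, y}, x, y, v)"
  have fAA: "finite ?AA" using fV by simp
  have fL: "finite (verts (link H A))" for A using fV by (simp add: link_def)
  have foff: "finite (?off e v)" if "e \<in> edges H" for e v
    by (rule finite_subset[of _ "e \<times> e"]) (use uniform_edgeD[OF H that] in \<open>auto simp: swaps_def\<close>)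
  have "card ?X \<le> card ?Y"
  proof (rule card_inj_on_le)
    \<comment> \<open>As \<open>x\<close> and \<open>y\<close> lie in \<open>e\<close>, the edge is
      recovered from \<open>e - {x, y}\<close>, \<open>x\<close> and \<open>y\<close>.\<close>
    show "inj_on ?f ?X" by (auto simp: inj_on_def swaps_def)
    show "finite ?Y" using fAA ordered_triangles_le(1)[OF fL] by blast
    show "?f ` ?X \<subseteq> ?Y"
    proof clarify
      fix e v x y assume *: "e \<in> edges H" "v \<in> verts H" "v \<notin> e" "x \<in> swaps H e v"
        "y \<in> swaps H e v" "x \<noteq> y"
      then have "x \<in> e" "y \<in> e" by (auto simp: swaps_def)
      then have "e - {x, y} \<in> ?AA"
        using uniform_edgeD[OF H *(1)] \<open>x \<noteq> y\<close> by (auto simp: card_Diff_subset)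
      then show "(e - {x, y} \<in> ?AA) \<and> (x, y, v) \<in> ordered_triangles (link H (e - {x, y}))"
        using swaps_triangle_link[OF H *(1) _ *(4-6)] * by (simp add: ordered_triangles_def)
    qed
  qed
  also have "card ?Y = (\<Sum>A\<in>?AA. card (ordered_triangles (link H A)))"
    using fAA ordered_triangles_le(1)[OF fL] by simp
  also have "\<dots> \<le> (\<Sum>A\<in>?AA. 27 * card (triangles (link H A)))"
    by (intro sum_mono ordered_triangles_le(2)[OF fL])
  finally have X: "card ?X \<le> 27 * (\<Sum>A\<in>?AA. card (triangles (link H A)))"
    by (simp add: sum_distrib_left)
  have cX: "card ?X = (\<Sum>e\<in>edges H. \<Sum>v\<in>verts H - e. card (?off e v))"
  proof -
    have "card ?X = (\<Sum>e\<in>edges H. card (SIGMA v:verts H - e. ?off e v))"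
      by (rule card_SigmaI[OF fE]) (use foff fV in auto)
    also have "\<dots> = (\<Sum>e\<in>edges H. \<Sum>v\<in>verts H - e. card (?off e v))"
      by (intro sum.cong refl card_SigmaI) (use foff fV in auto)
    finally show ?thesis .
  qed
  have "(\<Sum>S | S \<subseteq> verts H \<and> card S = r - 1. (codegree H S)\<^sup>2) =
      (\<Sum>e\<in>edges H. \<Sum>S | S \<subseteq> e \<and> card S = r - 1. codegree H S)"
    by (simp add: power2_eq_square sum_codegree_mult[OF H])
  also have "\<dots> \<le> (\<Sum>e\<in>edges H. card (verts H) + (\<Sum>v\<in>verts H - e. card (?off e v)))"
    using r by (intro sum_mono sum_codegree_subsets_edge_le[OF H]) auto
  also have "\<dots> = card (verts H) * card (edges H) + card ?X"
    by (simp add: sum.distrib cX)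
  finally show ?thesis using X by linarith
qed

section \<open>Sets of low codegree and the variance argument\<close>

text \<open>The pair \<open>(A, v)\<close> is determined by \<open>S = insert v A\<close> and
  \<open>v\<close>, because \<open>v\<close> is not in \<open>A\<close>; so each \<open>S\<close> in
  \<open>B\<close> arises at most \<open>k\<close> times.\<close>

lemma sum_card_insert_mem:
  assumes fV: "finite V" and B: "B \<subseteq> {S. S \<subseteq> V \<and> card S = k}"
  shows "(\<Sum>A | A \<subseteq> V \<and> card A = k - 1. card {v \<in> V - A. insert v A \<in> B}) \<le> k * card B"
proof -
  let ?AA = "{A. A \<subseteq> V \<and> card A = k - 1}"
  have fB: "finite B" by (rule finite_subset[OF B]) (use fV in simp)
  have "(\<Sum>A\<in>?AA. card {v \<in> V - A. insert v A \<in> B}) = card (SIGMA A:?AA. {v \<in> V - A. insert v A \<in> B})"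
    by (rule card_SigmaI[symmetric]) (use fV in auto)
  also have "\<dots> \<le> card (SIGMA S:B. S)"
  proof (rule card_inj_on_le)
    show "inj_on (\<lambda>(A, v). (insert v A, v)) (SIGMA A:?AA. {v \<in> V - A. insert v A \<in> B})"
      by (auto simp: inj_on_def dest: insert_ident[THEN iffD1, rotated 2])
    show "finite (SIGMA S:B. S)" using fB B fV by (intro finite_SigmaI) (auto intro: finite_subset)
  qed auto
  also have "\<dots> = (\<Sum>S\<in>B. card S)"
    using fB B fV by (intro card_SigmaI) (auto intro: finite_subset)
  also have "\<dots> = (\<Sum>S\<in>B. k)" by (intro sum.cong) (use B in auto)
  finally show ?thesis by (simp add: mult.commute)
qed

text \<open>This is the argument for a fixed \<open>n\<close>: \<tau> bounds the triangles of each
  link, \<gamma> is the gap between \<open>1 / r\<close> and \<open>c\<close>, and the last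
  hypothesis replaces the little-o condition.\<close>

lemma card_edges_le:
  fixes c \<gamma> :: real
  assumes H: "uniform r H" and r: "r \<ge> 2" and n: "n = card (verts H)" "n \<ge> r"
    and \<gamma>: "\<gamma> = 1 / real r - c" "\<gamma> > 0"
    and tri: "\<And>A. A \<subseteq> verts H \<Longrightarrow> card A = r - 2 \<Longrightarrow> card (triangles (link H A)) \<le> \<tau>"
    and low: "\<And>A. A \<subseteq> verts H \<Longrightarrow> card A = r - 2 \<Longrightarrow> triangles (link H A) \<noteq> {} \<Longrightarrow>
      \<exists>v\<in>verts H - A. real (codegree H (insert v A)) < c * real n"
    and \<tau>: "27 * real \<tau> * (real r - 1) < \<gamma>\<^sup>2 * (real n)\<^sup>2"
  shows "real (card (edges H)) \<le> real n / real r ^ 2 * real (n choose (r - 1))"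
proof (rule ccontr)
  assume "\<not> ?thesis"
  then have big: "real (card (edges H)) > real n / real r ^ 2 * real (n choose (r - 1))" by simp
  have fV: "finite (verts H)" using H by (simp add: uniform_def)
  define P where "P = {S. S \<subseteq> verts H \<and> card S = r - 1}"
  define B where "B = {S \<in> P. real (codegree H S) < c * real n}"
  define t where "t = (\<Sum>A | A \<subseteq> verts H \<and> card A = r - 2. card (triangles (link H A)))"
  define N where "N = real (n choose (r - 1))"
  define m where "m = real (card (edges H))"
  \<comment> \<open>The average codegree over \<open>P\<close>, as every edge has \<open>r\<close>
    subsets of size \<open>r - 1\<close>.\<close>
  define D where "D = real r * m / N"
  have fP: "finite P" using fV by (simp add: P_def)
  have cP: "real (card P) = N" using n fV by (simp add: P_def N_def n_subsets)
  have N: "N > 0" using n by (simp add: N_def)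
  have "0 \<le> real n / real r ^ 2 * N" using N by simp
  then have m: "m > 0" using big unfolding m_def N_def by linarith
  have D: "D > real n / real r"
    using big r N unfolding D_def m_def[symmetric] N_def[symmetric]
    by (simp add: field_simps power2_eq_square)
  have s1: "(\<Sum>S\<in>P. real (codegree H S)) = real r * m"
  proof -
    have "r choose (r - 1) = r" using r binomial_symmetric[of "r - 1" r] by simp
    then have "(\<Sum>S\<in>P. codegree H S) = r * card (edges H)"
      using sum_codegree[OF H, of "r - 1"] by (simp add: P_def)
    then show ?thesis by (metis m_def of_nat_mult of_nat_sum)
  qed
  have s2: "(\<Sum>S\<in>P. (real (codegree H S))\<^sup>2) \<le> real n * m + 27 * real t"
  proof -
    have "real (\<Sum>S\<in>P. (codegree H S)\<^sup>2) \<le> real (n * card (edges H) + 27 * t)"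
      using sum_codegree_square_le[OF H r] unfolding P_def t_def n of_nat_le_iff .
    then show ?thesis by (simp add: m_def)
  qed
  \<comment> \<open>The squares are expanded about the mean. Since \<open>r * D > n\<close>, the
    upper bound obtained for the sum is strictly below \<open>27 * t\<close>.\<close>
  have "(\<Sum>S\<in>P. (real (codegree H S) - D)\<^sup>2) =
      (\<Sum>S\<in>P. (real (codegree H S))\<^sup>2) - 2 * D * (\<Sum>S\<in>P. real (codegree H S)) + N * D\<^sup>2"
    by (simp add: power2_diff sum.distrib sum_subtractf sum_distrib_left sum_distrib_right cP
        mult_ac)
  also have "\<dots> \<le> real n * m + 27 * real t - 2 * D * (real r * m) + N * D\<^sup>2"
    using s1 s2 by simp
  also have "N * D\<^sup>2 = D * (real r * m)" using N by (simp add: D_def power2_eq_square)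
  finally have "(\<Sum>S\<in>P. (real (codegree H S) - D)\<^sup>2) \<le> 27 * real t - m * (real r * D - real n)"
    by (simp add: algebra_simps)
  moreover have "m * (real r * D - real n) > 0" using m D r by (simp add: field_simps)
  ultimately have var: "(\<Sum>S\<in>P. (real (codegree H S) - D)\<^sup>2) < 27 * real t" by linarith
  have "real (card B) * (\<gamma> * real n)\<^sup>2 = (\<Sum>S\<in>B. (\<gamma> * real n)\<^sup>2)" by simp
  also have "\<dots> \<le> (\<Sum>S\<in>B. (real (codegree H S) - D)\<^sup>2)"
  proof (rule sum_mono)
    fix S assume "S \<in> B"
    \<comment> \<open>A codegree below \<open>c * n\<close> is more than \<open>\<gamma> * n\<close>
      away from \<open>D\<close>, which exceeds \<open>n / r\<close>.\<close>
    then have "\<gamma> * real n \<le> D - real (codegree H S)" using D by (simp add: B_def \<gamma> algebra_simps)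
    then have "(\<gamma> * real n)\<^sup>2 \<le> (D - real (codegree H S))\<^sup>2"
      using \<gamma> by (intro power_mono) auto
    then show "(\<gamma> * real n)\<^sup>2 \<le> (real (codegree H S) - D)\<^sup>2" by (simp add: power2_commute)
  qed
  also have "\<dots> \<le> (\<Sum>S\<in>P. (real (codegree H S) - D)\<^sup>2)"
    using fP by (intro sum_mono2) (auto simp: B_def)
  finally have lower: "real (card B) * (\<gamma> * real n)\<^sup>2 < 27 * real t" using var by linarith
  \<comment> \<open>A link with a triangle has some \<open>v\<close> with \<open>insert v A\<close>
    in \<open>B\<close>, so its at most \<tau> triangles are charged to such \<open>v\<close>; the
    other links contribute 0.\<close>
  have "t \<le> (\<Sum>A | A \<subseteq> verts H \<and> card A = r - 2. \<tau> * card {v \<in> verts H - A. insert v A \<in> B})"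
    unfolding t_def
  proof (rule sum_mono)
    fix A assume "A \<in> {A. A \<subseteq> verts H \<and> card A = r - 2}"
    then have A: "A \<subseteq> verts H" "card A = r - 2" by auto
    show "card (triangles (link H A)) \<le> \<tau> * card {v \<in> verts H - A. insert v A \<in> B}"
    proof (cases "triangles (link H A) = {}")
      case False
      then obtain v where v: "v \<in> verts H - A" "real (codegree H (insert v A)) < c * real n"
        using low[OF A] by blast
      have "insert v A \<in> B"
        using v A r finite_subset[OF A(1) fV] by (auto simp: B_def P_def)
      then have "{v \<in> verts H - A. insert v A \<in> B} \<noteq> {}" using v by blast
      then have "1 \<le> card {v \<in> verts H - A. insert v A \<in> B}"
        using fV by (simp add: Suc_le_eq card_gt_0_iff)
      then have "\<tau> * 1 \<le> \<tau> * card {v \<in> verts H - A. insert v A \<in> B}" by (rule mult_le_mono2)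
      then show ?thesis using tri[OF A] by linarith
    qed simp
  qed
  also have "\<dots> \<le> \<tau> * ((r - 1) * card B)"
    using sum_card_insert_mem[OF fV, of B "r - 1"]
    by (auto simp: sum_distrib_left[symmetric] B_def P_def numeral_2_eq_2)
  finally have "real t \<le> real (\<tau> * ((r - 1) * card B))" by (rule of_nat_mono)
  then have "27 * real t \<le> (27 * real \<tau> * (real r - 1)) * real (card B)"
    using r by (simp add: of_nat_diff)
  \<comment> \<open>This is not strict, since \<open>B\<close> may be empty; the contradiction rests
    on the strictness of \<open>lower\<close>.\<close>
  also have "\<dots> \<le> (\<gamma>\<^sup>2 * (real n)\<^sup>2) * real (card B)" using \<tau> by (intro mult_right_mono) auto
  finally show False using lower by (simp add: power_mult_distrib mult_ac)
qed

section \<open>From the fixed-order bound to all large orders\<close>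

theorem theorem2p3:
  fixes r :: nat and F :: "'a hypergraph"
  assumes "r \<ge> 2"
    and "simple_graph F"
    and "(\<lambda>n. real (turan_triangles n F)) \<in> o(\<lambda>n. real n ^ 2)"
    and "\<exists>c::real. c < 1 / real r \<and>
      (\<forall>\<^sub>F n in sequentially. \<forall>G :: nat hypergraph.
        simple_graph G \<and> card (verts G) = n \<and> \<not> contains_copy G F \<and> triangles G \<noteq> {} \<longrightarrow>
        (\<exists>v\<in>verts G. real (degree G v) < c * real n))"
  shows "\<forall>\<^sub>F n in sequentially.
    real (turan_number r n (suspension r F)) \<le> real n / real r ^ 2 * real (n choose (r - 1))"
proof -
  note r = assms(1)
  from assms(4) obtain c0 :: real and n0 where c0: "c0 < 1 / real r" and
    deg: "\<And>G :: nat hypergraph. card (verts G) \<ge> n0 \<Longrightarrow> simple_graph G \<Longrightarrow>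
      \<not> contains_copy G F \<Longrightarrow> triangles G \<noteq> {} \<Longrightarrow>
      \<exists>v\<in>verts G. real (degree G v) < c0 * real (card (verts G))"
    unfolding eventually_sequentially by blast
  \<comment> \<open>Nonnegativity allows passing from \<open>c0\<close> times the order of a link to
    \<open>c * n\<close>, and \<open>c\<close> is still below \<open>1 / r\<close>.\<close>
  define c where "c = max c0 0"
  define \<gamma> where "\<gamma> = 1 / real r - c"
  have \<gamma>: "\<gamma> > 0" using c0 r by (simp add: \<gamma>_def c_def)
  \<comment> \<open>Chosen so that \<open>27 * \<delta> * r\<close> is half of
    \<open>\<gamma>\<^sup>2\<close>, which leaves room for the strict inequality.\<close>
  define \<delta> where "\<delta> = \<gamma>\<^sup>2 / (54 * real r)"
  have \<delta>: "\<delta> > 0" using \<gamma> r by (simp add: \<delta>_def)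
  obtain n1 where n1: "\<And>k. k \<ge> n1 \<Longrightarrow> real (turan_triangles k F) \<le> \<delta> * (real k)\<^sup>2"
    using landau_o.smallD[OF assms(3) \<delta>] by (auto simp: eventually_sequentially)
  \<comment> \<open>Adding \<open>r\<close> to the threshold keeps the order
    \<open>n - (r - 2)\<close> of every link above both \<open>n0\<close> and
    \<open>n1\<close>.\<close>
  have main: "real (card (edges H)) \<le> real n / real r ^ 2 * real (n choose (r - 1))"
    if n: "n \<ge> n0 + n1 + r" and H: "uniform r H" "card (verts H) = n"
      and free: "\<not> contains_copy H (suspension r F)" for n and H :: "nat hypergraph"
  proof -
    let ?k = "n - (r - 2)"
    have fV: "finite (verts H)" using H by (simp add: uniform_def)
    have link: "simple_graph (link H A)" "\<not> contains_copy (link H A) F"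
      "card (verts (link H A)) = ?k" "finite A"
      if A: "A \<subseteq> verts H" "card A = r - 2" for A
    proof -
      show fA: "finite A" using A fV finite_subset by blast
      show "simple_graph (link H A)" by (rule simple_graph_link[OF H(1) A(2) r A(1)])
      show "\<not> contains_copy (link H A) F" using contains_copy_suspension[OF A(2) fA A(1)] free by blast
      show "card (verts (link H A)) = ?k" using A H(2) fA by (simp add: link_def card_Diff_subset)
    qed
    show ?thesis
    proof (rule card_edges_le[OF H(1) r H(2)[symmetric] _ \<gamma>_def \<gamma>])
      show "r \<le> n" using n by simp
      show "card (triangles (link H A)) \<le> turan_triangles ?k F"
        if A: "A \<subseteq> verts H" "card A = r - 2" for A
        using card_triangles_le_turan_triangles[OF link(1,2)[OF A]] link(3)[OF A] by simp
      show "\<exists>v\<in>verts H - A. real (codegree H (insert v A)) < c * real n"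
        if A: "A \<subseteq> verts H" "card A = r - 2" and T: "triangles (link H A) \<noteq> {}" for A
      proof -
        have "n0 \<le> ?k" using n r by linarith
        then obtain v where v: "v \<in> verts (link H A)" "real (degree (link H A) v) < c0 * real ?k"
          using deg[OF _ link(1,2)[OF A] T] unfolding link(3)[OF A] by blast
        have vA: "v \<in> verts H - A" using v by (simp add: link_def)
        have "real (codegree H (insert v A)) \<le> real (degree (link H A) v)"
          using codegree_insert_le_degree_link[OF H(1), of v A] vA by simp
        also have "\<dots> < c0 * real ?k" by (rule v(2))
        also have "\<dots> \<le> c * real n" unfolding c_def by (intro mult_mono) auto
        finally show ?thesis using vA by blast
      qed
      have "real (turan_triangles ?k F) \<le> \<delta> * (real ?k)\<^sup>2" using n r by (intro n1) simp
      also have "\<dots> \<le> \<delta> * (real n)\<^sup>2" using \<delta> by (intro mult_left_mono power_mono) auto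
      finally have "27 * real (turan_triangles ?k F) * (real r - 1) \<le>
          27 * (\<delta> * (real n)\<^sup>2) * (real r - 1)"
        using r by (intro mult_right_mono mult_left_mono) auto
      also have "\<dots> \<le> 27 * (\<delta> * (real n)\<^sup>2) * real r"
        using \<delta> by (intro mult_left_mono) auto
      also have "\<dots> = \<gamma>\<^sup>2 * (real n)\<^sup>2 / 2" using r by (simp add: \<delta>_def field_simps)
      also have "\<dots> < \<gamma>\<^sup>2 * (real n)\<^sup>2" using \<gamma> n r by simp
      finally show "27 * real (turan_triangles ?k F) * (real r - 1) < \<gamma>\<^sup>2 * (real n)\<^sup>2" .
    qed
  qed
  show ?thesis unfolding eventually_sequentially
  proof (intro exI allI impI)
    fix n assume n: "n \<ge> n0 + n1 + r"
    let ?X = "{card (edges H) | H :: nat hypergraph.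
            uniform r H \<and> card (verts H) = n \<and> \<not> contains_copy H (suspension r F)}"
    let ?b = "real n / real r ^ 2 * real (n choose (r - 1))"
    show "real (turan_number r n (suspension r F)) \<le> ?b"
    \<comment> \<open>Without any suspension-free host the supremum is \<open>Sup {} = 0\<close>,
      and the bound is nonnegative.\<close>
    proof (cases "?X = {}")
      case True
      then show ?thesis unfolding turan_number_def by (simp only: Sup_nat_empty) simp
    next
      case False
      \<comment> \<open>The supremum lives in the naturals, so the real bound is rounded down
        first.\<close>
      have "turan_number r n (suspension r F) \<le> nat \<lfloor>?b\<rfloor>"
        unfolding turan_number_def
      proof (rule cSup_least[OF False])
        fix x assume "x \<in> ?X"
        then have "real x \<le> ?b" using main[OF n] by blast
        then show "x \<le> nat \<lfloor>?b\<rfloor>" by (simp add: le_nat_floor)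
      qed
      then show ?thesis by (simp add: le_floor_iff nat_le_iff le_nat_iff)
    qed
  qed
qed

end
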